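(* Let $\mathcal{S}\subseteq\mathbb{R}^d$ be open and let $\mathcal{F}:\mathcal{S}\to\mathbb{R}^r$ and $\mathcal{G}:\mathcal{S}\to\mathbb{R}^p$ be differentiable functions. Assume that $\mathcal{F}$, $\mathcal{G}$ and their derivatives $\mathcal{F}'$, $\mathcal{G}'$ are Lipschitz continuous on $\mathcal{S}$ with constants $L_{\mathcal{F}}$, $L_{\mathcal{G}}$, $L'_{\mathcal{F}}$ and $L'_{\mathcal{G}}$ respectively. Let $Q:\mathcal{S}\to\mathbb{R}$ be the function $$Q(s)=-\bar\alpha\,\log\bigl(1+\|\mathcal{F}(s)-\bar f\|^2_{V_f}\bigr)-\bar\beta\,\log\bigl(1+\|\mathcal{G}(s)-\bar g\|^2_{V_g}\bigr)+C,$$ where $\bar\alpha,\bar\beta,\bar f,\bar g,V_f,V_g$ are the weighted sums, means and covariance matrices of the data defined in the context and $C\in\mathbb{R}$ is a constant not depending on $s$. Then the gradient $\nabla Q$ is bounded on $\mathcal{S}$ and Lipschitz continuous on $\mathcal{S}$ with some constant $L$.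
   Context: Data and weights: $f_1,\dots,f_M\in\mathbb{R}^r$ and $g_1,\dots,g_K\in\mathbb{R}^p$ are fixed observations, with fixed weights $\alpha_m\ge 0$ ($m=1,\dots,M$) and $\beta_k\ge 0$ ($k=1,\dots,K$), not depending on $s$ (posterior probabilities from an EM E-step), having positive sums. Define $$\bar\alpha=\sum_{m=1}^M\alpha_m,\quad \bar\beta=\sum_{k=1}^K\beta_k,\quad \bar f=\bar\alpha^{-1}\sum_{m=1}^M\alpha_m f_m,\quad \bar g=\bar\beta^{-1}\sum_{k=1}^K\beta_k g_k,$$ $$V_f=\bar\alpha^{-1}\sum_{m=1}^M\alpha_m f_mf_m^{\top}-\bar f\bar f^{\top},\qquad V_g=\bar\beta^{-1}\sum_{k=1}^K\beta_k g_kg_k^{\top}-\bar g\bar g^{\top}.$$ The symmetric matrices $V_f$ and $V_g$ are assumed invertible (hence positive definite). Notation: $\|v\|^2_{V}=v^{\top}V^{-1}v$ is the squared Mahalanobis norm associated with a symmetric positive definite matrix $V$. Vectors carry the Euclidean norm, and matrices (in particular the Jacobians $\mathcal{F}'(s)$, $\mathcal{G}'(s)$) the operator norm $\|A\|=\sup_{\|v\|=1}\|Av\|$. *)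

theory Defs
  imports "HOL-Analysis.Analysis"
begin

definition outer_prod :: "real ^ 'n \<Rightarrow> real ^ 'n \<Rightarrow> real ^ 'n ^ 'n" where
  "outer_prod u v = (\<chi> i j. u $ i * v $ j)"

text \<open>Weights and observations are indexed by \<open>1, \<dots>, n\<close>; their values at other
  indices play no role.\<close>

definition total_weight :: "nat \<Rightarrow> (nat \<Rightarrow> real) \<Rightarrow> real" where
  "total_weight n w = (\<Sum>i = 1..n. w i)"

definition weighted_mean :: "nat \<Rightarrow> (nat \<Rightarrow> real) \<Rightarrow> (nat \<Rightarrow> real ^ 'n) \<Rightarrow> real ^ 'n" where
  "weighted_mean n w x = inverse (total_weight n w) *\<^sub>R (\<Sum>i = 1..n. w i *\<^sub>R x i)"

definition weighted_cov :: "nat \<Rightarrow> (nat \<Rightarrow> real) \<Rightarrow> (nat \<Rightarrow> real ^ 'n) \<Rightarrow> real ^ 'n ^ 'n" where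
  "weighted_cov n w x =
     inverse (total_weight n w) *\<^sub>R (\<Sum>i = 1..n. w i *\<^sub>R outer_prod (x i) (x i))
     - outer_prod (weighted_mean n w x) (weighted_mean n w x)"

text \<open>Meaningful only for symmetric positive definite \<open>V\<close>: on a singular matrix
  \<^const>\<open>matrix_inv\<close> is unspecified.\<close>

definition mahalanobis_sq :: "real ^ 'n ^ 'n \<Rightarrow> real ^ 'n \<Rightarrow> real" where
  "mahalanobis_sq V v = v \<bullet> (matrix_inv V *v v)"

end

theory Submission
  imports Defs
begin

text \<open>With \<open>W = V\<^sup>-\<^sup>1\<close> and \<open>q u = u \<bullet> W u\<close>, positivity of \<open>W\<close> gives
  \<open>|W u|\<^sup>2 \<le> b q u\<close> for some \<open>b\<close>. Hence \<open>W u / (1 + q u)\<close>, which is half the gradient of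
  \<open>ln (1 + q u)\<close>, is bounded and Lipschitz on the whole space, although neither \<open>W u\<close> is bounded
  nor \<open>q\<close> is Lipschitz. By the chain rule the gradient of \<open>Q\<close> is a combination of adjoints of
  \<open>F' s\<close> and \<open>G' s\<close> applied to such fields; both factors are bounded (the derivative of a
  Lipschitz map is bounded by the Lipschitz constant) and Lipschitz, so the products are too.\<close>

section \<open>The derivative of a Lipschitz map\<close>

text \<open>Along a direction \<open>v\<close>, the difference quotients of \<open>F\<close> at
  \<open>s\<close> converge to \<open>A v\<close>, and once \<open>s + t v\<close> has entered the
  open set they have norm at most \<open>L * norm v\<close>; the bound passes to the limit.\<close>

lemma lipschitz_on_imp_norm_derivative_le:
  fixes F :: "'a::real_normed_vector \<Rightarrow> 'b::real_normed_vector" and A :: "'a \<Rightarrow>\<^sub>L 'b"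
  assumes "open S" and "s \<in> S" and L: "L-lipschitz_on S F"
    and F: "(F has_derivative blinfun_apply A) (at s)"
  shows "norm A \<le> L"
proof (rule norm_blinfun_bound)
  show "0 \<le> L"
    using L by (rule lipschitz_on_nonneg)
  fix v
  have "((\<lambda>t. F (s + t *\<^sub>R v)) has_derivative (\<lambda>t. A (t *\<^sub>R v))) (at (0::real))"
    by (rule has_derivative_compose[of "\<lambda>t. s + t *\<^sub>R v"])
       (auto intro!: derivative_eq_intros simp: F)
  then have "((\<lambda>t. norm (F (s + t *\<^sub>R v) - F s - t *\<^sub>R A v) / \<bar>t\<bar>) \<longlongrightarrow> 0) (at (0::real))"
    by (simp add: has_derivative_iff_norm blinfun.scaleR_right)
  then have "((\<lambda>t. (F (s + t *\<^sub>R v) - F s) /\<^sub>R t - A v) \<longlongrightarrow> 0) (at (0::real))"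
  proof (rule Lim_null_comparison[rotated])
    have "norm ((F (s + t *\<^sub>R v) - F s) /\<^sub>R t - A v) = norm (F (s + t *\<^sub>R v) - F s - t *\<^sub>R A v) / \<bar>t\<bar>"
      if "t \<noteq> 0" for t :: real
    proof -
      have "(F (s + t *\<^sub>R v) - F s) /\<^sub>R t - A v = (F (s + t *\<^sub>R v) - F s - t *\<^sub>R A v) /\<^sub>R t"
        using that by (simp add: scaleR_diff_right)
      then show ?thesis
        by (simp add: divide_inverse mult.commute)
    qed
    then show "\<forall>\<^sub>F t in at (0::real). norm ((F (s + t *\<^sub>R v) - F s) /\<^sub>R t - A v)
        \<le> norm (F (s + t *\<^sub>R v) - F s - t *\<^sub>R A v) / \<bar>t\<bar>"
      by (auto simp: eventually_at_filter)
  qed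
  then have lim: "((\<lambda>t. (F (s + t *\<^sub>R v) - F s) /\<^sub>R t) \<longlongrightarrow> A v) (at (0::real))"
    by (rule LIM_zero_cancel)
  have "((\<lambda>t. s + t *\<^sub>R v) \<longlongrightarrow> s + 0 *\<^sub>R v) (at (0::real))"
    by (intro tendsto_intros)
  then have "\<forall>\<^sub>F t in at (0::real). s + t *\<^sub>R v \<in> S"
    using \<open>open S\<close> \<open>s \<in> S\<close> by (intro topological_tendstoD) auto
  then have "\<forall>\<^sub>F t in at (0::real). norm ((F (s + t *\<^sub>R v) - F s) /\<^sub>R t) \<le> L * norm v"
  proof eventually_elim
    case (elim t)
    then have "norm (F (s + t *\<^sub>R v) - F s) \<le> L * norm (t *\<^sub>R v)"
      using lipschitz_onD[OF L, of "s + t *\<^sub>R v" s] \<open>s \<in> S\<close> by (simp add: dist_norm)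
    \<comment> \<open>At \<open>t = 0\<close> the quotient is 0, since \<open>inverse 0 = 0\<close>,
      and the bound holds because \<open>L\<close> is nonnegative.\<close>
    then show ?case
      using \<open>0 \<le> L\<close>
      by (cases "t = 0") (auto simp: pos_divide_le_eq mult_ac
          simp flip: divide_inverse_commute)
  qed
  then show "norm (A v) \<le> L * norm v"
    using lim by (intro Lim_norm_ubound[OF _ lim]) auto
qed

section \<open>The gradient field of \<open>ln (1 + u \<bullet> T u)\<close> for positive
  semidefinite \<open>T\<close>\<close>

text \<open>The form is nonnegative at \<open>x - t T x\<close> for every \<open>t\<close>.
  Expanding it there, with \<open>b\<close> a bound for the operator norm of \<open>T\<close>, and
  choosing \<open>t\<close> well leaves exactly the first inequality.\<close>

lemma psd_norm_sq_le:
  fixes T :: "'a::real_inner \<Rightarrow> 'a"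
  assumes T: "bounded_linear T" and sym: "\<And>x y. x \<bullet> T y = T x \<bullet> y"
    and psd: "\<And>x. 0 \<le> x \<bullet> T x"
  obtains b where "0 < b" and "\<And>x. (norm (T x))\<^sup>2 \<le> b * (x \<bullet> T x)"
    and "\<And>x. norm (T x) \<le> b * norm x"
proof -
  interpret T: bounded_linear T by fact
  obtain b where b: "0 < b" "\<And>x. norm (T x) \<le> norm x * b"
    using T.pos_bounded by blast
  have "(norm (T x))\<^sup>2 \<le> b * (x \<bullet> T x)" for x
  proof -
    \<comment> \<open>This value minimises \<open>b * t\<^sup>2 - 2 * t\<close>, the coefficient of
      \<open>(norm (T x))\<^sup>2\<close> in the upper bound for the form at
      \<open>x - t T x\<close>.\<close>
    let ?t = "1 / b"
    have "T x \<bullet> T (T x) \<le> norm (T x) * norm (T (T x))"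
      by (rule norm_cauchy_schwarz)
    also have "\<dots> \<le> norm (T x) * (norm (T x) * b)"
      by (intro mult_left_mono b) simp
    finally have le: "T x \<bullet> T (T x) \<le> b * (norm (T x))\<^sup>2"
      by (simp add: power2_eq_square mult_ac)
    have "0 \<le> (x - ?t *\<^sub>R T x) \<bullet> T (x - ?t *\<^sub>R T x)"
      by (rule psd)
    also have "\<dots> = x \<bullet> T x - 2 * ?t * (norm (T x))\<^sup>2 + ?t\<^sup>2 * (T x \<bullet> T (T x))"
      using sym[of x "T x"]
      by (simp add: T.diff T.scaleR inner_diff_left inner_diff_right power2_norm_eq_inner
          power_divide power2_eq_square[of b] diff_divide_distrib)
    also have "\<dots> \<le> x \<bullet> T x - 2 * ?t * (norm (T x))\<^sup>2 + ?t\<^sup>2 * (b * (norm (T x))\<^sup>2)"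
      using le by (intro add_left_mono mult_left_mono) auto
    also have "\<dots> = x \<bullet> T x - (norm (T x))\<^sup>2 / b"
      using b by (simp add: field_simps power2_eq_square)
    finally show ?thesis
      using b by (simp add: field_simps)
  qed
  then show thesis
    using b that by (simp add: mult.commute)
qed

lemma log_quadratic_gradient_bounds:
  fixes T :: "'a::real_inner \<Rightarrow> 'a"
  assumes T: "bounded_linear T" and sym: "\<And>x y. x \<bullet> T y = T x \<bullet> y"
    and psd: "\<And>x. 0 \<le> x \<bullet> T x"
  defines "h \<equiv> \<lambda>u. (2 / (1 + u \<bullet> T u)) *\<^sub>R T u"
  obtains B L where "\<And>u. norm (h u) \<le> B" and "L-lipschitz_on UNIV h"
proof -
  interpret T: bounded_linear T by fact
  obtain b where b: "0 < b" "\<And>x. (norm (T x))\<^sup>2 \<le> b * (x \<bullet> T x)"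
      "\<And>x. norm (T x) \<le> b * norm x"
    using psd_norm_sq_le[OF T sym psd] by blast
  define p where "p u = 1 + u \<bullet> T u" for u
  have p1: "1 \<le> p u" for u
    using psd by (simp add: p_def)
  have p0: "p u \<noteq> 0" for u
    using p1[of u] by auto
  have sq: "(norm (T u))\<^sup>2 \<le> b * p u" for u
    using b(2)[of u] b(1) by (simp add: p_def algebra_simps)
  \<comment> \<open>Since \<open>1 \<le> p u\<close>, the factor \<open>sqrt (p u)\<close> coming
    from \<open>sq\<close> may be enlarged to \<open>p u\<close>, which the denominator of
    \<open>h\<close> then cancels.\<close>
  have le: "norm (T u) \<le> sqrt b * p u" for u
  proof -
    have "(norm (T u))\<^sup>2 \<le> b * (p u)\<^sup>2"
      using sq[of u] b(1) p1[of u] self_le_power[of "p u" 2]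
      by (meson less_imp_le mult_left_mono order_trans pos2)
    then have "norm (T u) \<le> sqrt (b * (p u)\<^sup>2)"
      by (rule real_le_rsqrt)
    then show ?thesis
      using p1[of u] by (simp add: real_sqrt_mult)
  qed
  have h: "h u = (2 / p u) *\<^sub>R T u" for u
    by (simp add: h_def p_def)
  have "norm (h u) \<le> 2 * sqrt b" for u
    using le[of u] p1[of u] by (simp add: h field_simps)
  moreover have "(6 * b)-lipschitz_on UNIV h"
  proof (rule lipschitz_onI)
    show "0 \<le> 6 * b"
      using b by simp
    fix u v
    \<comment> \<open>Symmetry of \<open>T\<close> makes the difference of the two forms factor like
      a difference of squares.\<close>
    have "p v - p u = (v - u) \<bullet> (T u + T v)"
      using sym[of v u]
      by (simp add: p_def inner_diff_left inner_add_right inner_commute[of "T v" u])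
    then have "\<bar>p v - p u\<bar> \<le> norm (v - u) * norm (T u + T v)"
      by (simp add: Cauchy_Schwarz_ineq2)
    also have "\<dots> \<le> norm (u - v) * (norm (T u) + norm (T v))"
      unfolding norm_minus_commute[of v] by (intro mult_left_mono norm_triangle_ineq norm_ge_zero)
    \<comment> \<open>The increment of \<open>p\<close> is estimated only together with the factor
      \<open>norm (T v)\<close>: both resulting products of norms are at most
      \<open>b * p u * p v\<close>, so division by \<open>p u * p v\<close> leaves a global
      Lipschitz bound.\<close>
    finally have "\<bar>p v - p u\<bar> * norm (T v) \<le> norm (u - v) * (norm (T u) + norm (T v)) * norm (T v)"
      by (rule mult_right_mono) simp
    also have "\<dots> = norm (u - v) * (norm (T u) * norm (T v) + (norm (T v))\<^sup>2)"
      by (simp add: power2_eq_square algebra_simps)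
    also have "\<dots> \<le> norm (u - v) * ((sqrt b * p u) * (sqrt b * p v) + b * p v * p u)"
    proof (intro mult_left_mono add_mono mult_mono le norm_ge_zero)
      show "0 \<le> sqrt b * p u"
        using b(1) p1[of u] by simp
      have "b * p v * 1 \<le> b * p v * p u"
        using b(1) p1[of u] p1[of v] by (intro mult_left_mono) auto
      then show "(norm (T v))\<^sup>2 \<le> b * p v * p u"
        using sq[of v] by simp
    qed
    also have "\<dots> = 2 * b * norm (u - v) * (p u * p v)"
      using b(1) by (simp add: algebra_simps flip: power2_eq_square)
    finally have 1: "\<bar>p v - p u\<bar> * norm (T v) / (p u * p v) \<le> 2 * b * norm (u - v)"
      using p1[of u] p1[of v] by (simp add: divide_le_eq)
    have 2: "norm (T (u - v)) / p u \<le> b * norm (u - v)"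
    proof -
      have "norm (T (u - v)) * 1 \<le> b * norm (u - v) * p u"
        using b p1[of u] by (intro mult_mono) auto
      then show ?thesis
        using p1[of u] by (simp add: divide_le_eq)
    qed
    \<comment> \<open>First the numerator changes over the fixed denominator \<open>p u\<close>,
      then the denominator changes under the fixed numerator \<open>T v\<close>. The two terms
      contribute \<open>b\<close> and \<open>2 * b\<close>, and the outer factor 2 yields
      \<open>6 * b\<close>.\<close>
    have "h u - h v = 2 *\<^sub>R ((1 / p u) *\<^sub>R T (u - v) + ((p v - p u) / (p u * p v)) *\<^sub>R T v)"
    proof -
      have "1 / p v = 1 / p u - (p v - p u) / (p u * p v)"
        using p0[of u] p0[of v] by (simp add: field_simps)
      then have "h v = 2 *\<^sub>R ((1 / p u - (p v - p u) / (p u * p v)) *\<^sub>R T v)"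
        by (simp add: h flip: \<open>1 / p v = _\<close>)
      moreover have "h u = 2 *\<^sub>R ((1 / p u) *\<^sub>R T u)"
        by (simp add: h)
      ultimately show ?thesis
        by (simp only: T.diff scaleR_diff_left scaleR_diff_right scaleR_add_right) simp
    qed
    then have "norm (h u - h v) = 2 * norm ((1 / p u) *\<^sub>R T (u - v) + ((p v - p u) / (p u * p v)) *\<^sub>R T v)"
      by simp
    also have "\<dots> \<le> 2 * (norm (T (u - v)) / p u + \<bar>p v - p u\<bar> * norm (T v) / (p u * p v))"
      using p1[of u] p1[of v] by (intro mult_left_mono norm_triangle_le) (auto simp: abs_mult)
    also have "\<dots> \<le> 6 * b * norm (u - v)"
      using 1 2 by simp
    finally show "dist (h u) (h v) \<le> 6 * b * dist u v"
      by (simp add: dist_norm)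
  qed
  ultimately show thesis
    using that by blast
qed

section \<open>Composition with a Lipschitz map\<close>

text \<open>Serves to bound a vector known only through its inner products, by pairing it with
  itself and cancelling one factor \<open>norm x\<close>.\<close>

lemma norm_le_of_inner_self:
  fixes x :: "'a::real_inner"
  assumes "x \<bullet> x \<le> b * norm x" and "0 \<le> b"
  shows "norm x \<le> b"
  using assms by (cases "x = 0") (auto simp flip: power2_norm_eq_inner simp: power2_eq_square)

text \<open>By the chain rule the gradient at \<open>s\<close> is the adjoint of \<open>F' s\<close>
  applied to \<open>h (F s - c)\<close>. Both factors are bounded and Lipschitz on \<open>S\<close>,
  hence so is the result.\<close>

lemma log_quadratic_comp_gradient:
  fixes F :: "'a::euclidean_space \<Rightarrow> 'b::euclidean_space" and F' :: "'a \<Rightarrow> 'a \<Rightarrow>\<^sub>L 'b"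
  assumes "open S" and F: "\<And>s. s \<in> S \<Longrightarrow> (F has_derivative blinfun_apply (F' s)) (at s)"
    and L: "L-lipschitz_on S F" and L': "L'-lipschitz_on S F'"
    and T: "bounded_linear T" and sym: "\<And>x y. x \<bullet> T y = T x \<bullet> y"
    and psd: "\<And>x. 0 \<le> x \<bullet> T x"
  shows "\<exists>D. (\<forall>s\<in>S. GDERIV (\<lambda>s. ln (1 + (F s - c) \<bullet> T (F s - c))) s :> D s)
    \<and> bounded (D ` S) \<and> (\<exists>K. K-lipschitz_on S D)"
proof -
  interpret T: bounded_linear T by fact
  define h where "h u = (2 / (1 + u \<bullet> T u)) *\<^sub>R T u" for u
  obtain B K where B: "\<And>u. norm (h u) \<le> B" and K: "K-lipschitz_on UNIV h"
    using log_quadratic_gradient_bounds[OF T sym psd] unfolding h_def by blast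
  define D where "D s = adjoint (F' s) (h (F s - c))" for s
  \<comment> \<open>All later estimates use the adjoint through this identity alone.\<close>
  have D: "x \<bullet> D s = F' s x \<bullet> h (F s - c)" for x s
    unfolding D_def by (simp add: adjoint_works blinfun.bounded_linear_right bounded_linear.linear)
  have F'_le: "norm (F' s) \<le> L" if "s \<in> S" for s
    using lipschitz_on_imp_norm_derivative_le[OF \<open>open S\<close> that L F[OF that]] .
  have nonneg: "0 \<le> B" "0 \<le> K" "0 \<le> L" "0 \<le> L'"
    using order_trans[OF norm_ge_zero B] K L L' by (auto dest: lipschitz_on_nonneg)
  have "GDERIV (\<lambda>s. ln (1 + (F s - c) \<bullet> T (F s - c))) s :> D s" if "s \<in> S" for s
  proof -
    have pos: "0 < 1 + (F s - c) \<bullet> T (F s - c)"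
      using psd[of "F s - c"] by simp
    let ?u = "F s - c"
    \<comment> \<open>Symmetry merges the two terms of the product rule, which is where the factor 2
      in \<open>h\<close> comes from.\<close>
    have swap: "?u \<bullet> T (F' s y) = F' s y \<bullet> T ?u" for y
      by (metis sym inner_commute)
    have der: "((\<lambda>s. 1 + (F s - c) \<bullet> T (F s - c)) has_derivative
        (\<lambda>x. ?u \<bullet> T (F' s x) + F' s x \<bullet> T ?u)) (at s)"
      using F[OF that] by (auto intro!: derivative_eq_intros T.has_derivative)
    show ?thesis
      unfolding gderiv_def D
      by (rule has_derivative_eq_rhs[OF has_derivative_ln[OF _ der, OF pos]])
         (simp add: swap h_def divide_inverse mult_ac)
  qed
  moreover have "norm (D s) \<le> L * B" if "s \<in> S" for s
  proof (rule norm_le_of_inner_self)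
    have "D s \<bullet> D s \<le> norm (F' s (D s)) * norm (h (F s - c))"
      unfolding D by (rule norm_cauchy_schwarz)
    also have "\<dots> \<le> L * norm (D s) * B"
      using F'_le[OF that] nonneg
      by (intro mult_mono B order_trans[OF norm_blinfun] mult_right_mono) auto
    finally show "D s \<bullet> D s \<le> L * B * norm (D s)"
      by (simp add: mult_ac)
  qed (use nonneg in simp)
  then have "bounded (D ` S)"
    by (auto simp: bounded_iff)
  moreover have "(L * K * L + L' * B)-lipschitz_on S D"
  proof (rule lipschitz_onI)
    show "0 \<le> L * K * L + L' * B"
      using nonneg by simp
    fix s t assume s: "s \<in> S" and t: "t \<in> S"
    define d where "d = D s - D t"
    let ?hs = "h (F s - c)" and ?ht = "h (F t - c)"
    have "norm (D s - D t) \<le> (L * K * L + L' * B) * norm (s - t)"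
    proof (rule norm_le_of_inner_self, fold d_def)
      have "d \<bullet> d = F' s d \<bullet> ?hs - F' t d \<bullet> ?ht"
        by (subst (2) d_def) (simp add: inner_diff_right D)
      \<comment> \<open>Product-rule splitting. The first term gives \<open>L * K * L\<close>: the
        bound on \<open>F'\<close>, then the Lipschitz constants of \<open>h\<close> and
        \<open>F\<close>. The second gives \<open>L' * B\<close>.\<close>
      also have "\<dots> = F' s d \<bullet> (?hs - ?ht) + (F' s - F' t) d \<bullet> ?ht"
        by (simp add: inner_diff_right inner_diff_left blinfun.diff_left)
      also have "\<dots> \<le> norm (F' s d) * norm (?hs - ?ht) + norm ((F' s - F' t) d) * norm ?ht"
        by (intro add_mono norm_cauchy_schwarz)
      also have "\<dots> \<le> (L * norm d) * (K * (L * norm (s - t))) + (L' * norm (s - t) * norm d) * B"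
      proof (intro add_mono mult_mono B)
        show "norm (F' s d) \<le> L * norm d"
          using F'_le[OF s] by (intro order_trans[OF norm_blinfun] mult_right_mono) auto
        have "norm (?hs - ?ht) \<le> K * norm (F s - F t)"
          using lipschitz_onD[OF K, of "F s - c" "F t - c"] by (simp add: dist_norm)
        also have "\<dots> \<le> K * (L * norm (s - t))"
          using lipschitz_onD[OF L s t] nonneg by (intro mult_left_mono) (auto simp: dist_norm)
        finally show "norm (?hs - ?ht) \<le> K * (L * norm (s - t))" .
        show "norm ((F' s - F' t) d) \<le> L' * norm (s - t) * norm d"
          using lipschitz_onD[OF L' s t]
          by (intro order_trans[OF norm_blinfun] mult_right_mono) (auto simp: dist_norm)
      qed (use nonneg in auto)
      finally show "d \<bullet> d \<le> (L * K * L + L' * B) * norm (s - t) * norm d"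
        by (simp add: algebra_simps)
    qed (use nonneg in simp)
    then show "dist (D s) (D t) \<le> (L * K * L + L' * B) * dist s t"
      by (simp add: dist_norm)
  qed
  ultimately show ?thesis
    by blast
qed

section \<open>Weighted covariance matrices and their inverses\<close>

lemma outer_prod_mult_vec: "outer_prod u v *v x = (v \<bullet> x) *\<^sub>R u"
  by (simp add: outer_prod_def matrix_vector_mult_def inner_vec_def vec_eq_iff sum_distrib_left
      mult_ac)

text \<open>Written as a bilinear form, the covariance is visibly symmetric, and its diagonal values
  are variances of the scalars \<open>x \<bullet> f i\<close>.\<close>

lemma inner_weighted_cov:
  "x \<bullet> (weighted_cov n w f *v y) =
    (\<Sum>i = 1..n. w i * ((x \<bullet> f i) * (f i \<bullet> y))) / total_weight n w
    - (x \<bullet> weighted_mean n w f) * (weighted_mean n w f \<bullet> y)"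
proof -
  have "(\<Sum>i\<in>I. w i *\<^sub>R outer_prod (f i) (f i)) *v y = (\<Sum>i\<in>I. (w i * (f i \<bullet> y)) *\<^sub>R f i)"
    for I
    by (induction I rule: infinite_finite_induct)
       (auto simp: matrix_vector_mult_add_rdistrib outer_prod_mult_vec
         simp flip: scaleR_matrix_vector_assoc)
  then show ?thesis
    by (simp add: weighted_cov_def matrix_vector_mult_diff_rdistrib outer_prod_mult_vec
        inner_diff_right inner_sum_right mult_ac divide_inverse flip: scaleR_matrix_vector_assoc)
qed

lemma weighted_cov_sym: "x \<bullet> (weighted_cov n w f *v y) = (weighted_cov n w f *v x) \<bullet> y"
  unfolding inner_commute[of "weighted_cov n w f *v x"] inner_weighted_cov
  by (simp add: inner_commute mult_ac)

lemma weighted_cov_psd: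
  assumes w: "\<And>i. i \<in> {1..n} \<Longrightarrow> 0 \<le> w i" and pos: "0 < total_weight n w"
  shows "0 \<le> x \<bullet> (weighted_cov n w f *v x)"
proof -
  define a where "a = total_weight n w"
  define m where "m = x \<bullet> weighted_mean n w f"
  have a: "0 < a" "(\<Sum>i = 1..n. w i) = a"
    using pos by (auto simp: a_def total_weight_def)
  have m: "(\<Sum>i = 1..n. w i * (x \<bullet> f i)) = a * m"
    using a by (simp add: m_def weighted_mean_def inner_sum_right a_def)
  \<comment> \<open>This weighted sum of squared deviations of \<open>x \<bullet> f i\<close> from
    their mean \<open>m\<close> equals the total weight times the covariance form at
    \<open>x\<close>.\<close>
  have "0 \<le> (\<Sum>i = 1..n. w i * (x \<bullet> f i - m)\<^sup>2)"
    using w by (intro sum_nonneg) auto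
  also have "\<dots> = (\<Sum>i = 1..n. w i * (x \<bullet> f i)\<^sup>2 - 2 * m * (w i * (x \<bullet> f i)) + m\<^sup>2 * w i)"
    by (intro sum.cong refl) (simp add: power2_eq_square algebra_simps)
  also have "\<dots> = (\<Sum>i = 1..n. w i * (x \<bullet> f i)\<^sup>2) - a * m\<^sup>2"
    by (simp only: sum.distrib sum_subtractf a m flip: sum_distrib_left)
       (simp add: power2_eq_square)
  also have "\<dots> = a * (x \<bullet> (weighted_cov n w f *v x))"
    unfolding inner_weighted_cov a_def[symmetric] m_def[symmetric]
      inner_commute[of _ x]
    using a(1) by (simp add: field_simps power2_eq_square m_def[symmetric])
  finally show ?thesis
    using a(1) by (simp add: zero_le_mult_iff)
qed

text \<open>Writing \<open>x = V *v (matrix_inv V *v x)\<close> turns each property of the inverse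
  at \<open>x\<close> into the same property of \<open>V\<close> at
  \<open>matrix_inv V *v x\<close>.\<close>

lemma
  assumes V: "invertible V" and sym: "\<And>x y. x \<bullet> (V *v y) = (V *v x) \<bullet> y"
  shows matrix_inv_sym: "x \<bullet> (matrix_inv V *v y) = (matrix_inv V *v x) \<bullet> (y :: real ^ 'n)"
    and matrix_inv_psd: "(\<And>x. 0 \<le> x \<bullet> (V *v x)) \<Longrightarrow> 0 \<le> x \<bullet> (matrix_inv V *v x)"
proof -
  have "V ** matrix_inv V = mat 1"
    unfolding matrix_inv_def using V[unfolded invertible_def] by (rule someI2_ex) simp
  then have inv: "V *v (matrix_inv V *v z) = z" for z
    by (simp add: matrix_vector_mul_assoc)
  show sym': "x \<bullet> (matrix_inv V *v y) = (matrix_inv V *v x) \<bullet> y" for x y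
    using sym[of "matrix_inv V *v x" "matrix_inv V *v y"] by (simp add: inv)
  show "0 \<le> x \<bullet> (matrix_inv V *v x)" if "\<And>x. 0 \<le> x \<bullet> (V *v x)"
    using that[of "matrix_inv V *v x"] by (simp add: inv inner_commute)
qed

section \<open>Log-Mahalanobis terms and the gradient of \<open>Q\<close>\<close>

text \<open>The case where \<open>T\<close> is multiplication by the inverse covariance. It covers
  the \<open>F\<close> term and the \<open>G\<close> term of \<open>Q\<close> alike, with the
  weighted mean as \<open>c\<close>.\<close>

lemma log_mahalanobis_gradient:
  fixes F :: "real ^ 'd \<Rightarrow> real ^ 'r" and F' :: "real ^ 'd \<Rightarrow> (real ^ 'd) \<Rightarrow>\<^sub>L (real ^ 'r)"
  assumes w: "\<And>i. i \<in> {1..n} \<Longrightarrow> 0 \<le> w i" and pos: "0 < total_weight n w"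
    and V: "invertible (weighted_cov n w f)" and "open S"
    and F: "\<And>s. s \<in> S \<Longrightarrow> (F has_derivative blinfun_apply (F' s)) (at s)"
    and L: "L-lipschitz_on S F" and L': "L'-lipschitz_on S F'"
  shows "\<exists>D. (\<forall>s\<in>S. GDERIV (\<lambda>s. ln (1 + mahalanobis_sq (weighted_cov n w f) (F s - c))) s :> D s)
    \<and> bounded (D ` S) \<and> (\<exists>K. K-lipschitz_on S D)"
  unfolding mahalanobis_sq_def
  by (rule log_quadratic_comp_gradient[OF \<open>open S\<close> F L L'])
     (auto intro!: matrix_vector_mul_bounded_linear matrix_inv_sym matrix_inv_psd V
       weighted_cov_sym weighted_cov_psd w pos)

theorem theorem1:
  fixes S :: "(real ^ 'd) set"
    and F :: "real ^ 'd \<Rightarrow> real ^ 'r" and G :: "real ^ 'd \<Rightarrow> real ^ 'p"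
    and F' :: "real ^ 'd \<Rightarrow> (real ^ 'd) \<Rightarrow>\<^sub>L (real ^ 'r)"
    and G' :: "real ^ 'd \<Rightarrow> (real ^ 'd) \<Rightarrow>\<^sub>L (real ^ 'p)"
    and L\<^sub>F L\<^sub>G L\<^sub>F' L\<^sub>G' C :: real
    and M K :: nat and \<alpha> \<beta> :: "nat \<Rightarrow> real"
    and f :: "nat \<Rightarrow> real ^ 'r" and g :: "nat \<Rightarrow> real ^ 'p"
    and Q :: "real ^ 'd \<Rightarrow> real"
  assumes "\<And>m. m \<in> {1..M} \<Longrightarrow> \<alpha> m \<ge> 0" and "\<And>k. k \<in> {1..K} \<Longrightarrow> \<beta> k \<ge> 0"
    and "total_weight M \<alpha> > 0" and "total_weight K \<beta> > 0"
    and "invertible (weighted_cov M \<alpha> f)" and "invertible (weighted_cov K \<beta> g)"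
    and "open S"
    and "\<And>s. s \<in> S \<Longrightarrow> (F has_derivative blinfun_apply (F' s)) (at s)"
    and "\<And>s. s \<in> S \<Longrightarrow> (G has_derivative blinfun_apply (G' s)) (at s)"
    and "L\<^sub>F-lipschitz_on S F" and "L\<^sub>G-lipschitz_on S G"
    and "L\<^sub>F'-lipschitz_on S F'" and "L\<^sub>G'-lipschitz_on S G'"
    and "\<And>s. s \<in> S \<Longrightarrow>
      Q s = - total_weight M \<alpha> *
              ln (1 + mahalanobis_sq (weighted_cov M \<alpha> f) (F s - weighted_mean M \<alpha> f))
            - total_weight K \<beta> *
              ln (1 + mahalanobis_sq (weighted_cov K \<beta> g) (G s - weighted_mean K \<beta> g))
            + C"
  shows "\<exists>gradQ. (\<forall>s\<in>S. GDERIV Q s :> gradQ s) \<and> bounded (gradQ ` S)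
           \<and> (\<exists>L. L-lipschitz_on S gradQ)"
proof -
  define A where "A s = ln (1 + mahalanobis_sq (weighted_cov M \<alpha> f) (F s - weighted_mean M \<alpha> f))" for s
  define B where "B s = ln (1 + mahalanobis_sq (weighted_cov K \<beta> g) (G s - weighted_mean K \<beta> g))" for s
  let ?a = "total_weight M \<alpha>" and ?b = "total_weight K \<beta>"
  obtain D\<^sub>A where A: "\<And>s. s \<in> S \<Longrightarrow> GDERIV A s :> D\<^sub>A s" "bounded (D\<^sub>A ` S)" "\<exists>L. L-lipschitz_on S D\<^sub>A"
    using log_mahalanobis_gradient[OF assms(1,3,5,7,8,10,12)] unfolding A_def by blast
  obtain D\<^sub>B where B: "\<And>s. s \<in> S \<Longrightarrow> GDERIV B s :> D\<^sub>B s" "bounded (D\<^sub>B ` S)" "\<exists>L. L-lipschitz_on S D\<^sub>B"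
    using log_mahalanobis_gradient[OF assms(2,4,6,7,9,11,13)] unfolding B_def by blast
  define D where "D s = - ?a *\<^sub>R D\<^sub>A s - ?b *\<^sub>R D\<^sub>B s" for s
  have "GDERIV Q s :> D s" if "s \<in> S" for s
    unfolding gderiv_def
  \<comment> \<open>\<open>Q\<close> agrees with the formula only on \<open>S\<close>; openness of
    \<open>S\<close> makes this enough to transfer the derivative at \<open>s\<close>.\<close>
  proof (rule has_derivative_transform_within_open[OF _ \<open>open S\<close> that])
    show "((\<lambda>s. - ?a * A s - ?b * B s + C) has_derivative (\<lambda>h. h \<bullet> D s)) (at s)"
      using A(1)[OF that] B(1)[OF that]
      by (auto intro!: derivative_eq_intros simp: gderiv_def D_def inner_diff_right)
    show "- ?a * A t - ?b * B t + C = Q t" if "t \<in> S" for t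
      using assms(14)[OF that] by (simp add: A_def B_def)
  qed
  moreover have "bounded (D ` S)"
    unfolding D_def using A(2) B(2)
    by (intro bounded_minus_comp bounded_scaleR_comp)
  moreover obtain K\<^sub>A K\<^sub>B where K: "K\<^sub>A-lipschitz_on S D\<^sub>A" "K\<^sub>B-lipschitz_on S D\<^sub>B"
    using A(3) B(3) by blast
  have "(\<bar>- ?a\<bar> * K\<^sub>A + \<bar>?b\<bar> * K\<^sub>B)-lipschitz_on S D"
    unfolding D_def using K by (intro lipschitz_on_diff lipschitz_on_cmult)
  ultimately show ?thesis
    by blast
qed

end
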